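(* Let $\mathbf{f}=(f(i))_{i\ge 0}$ be the Fibonacci word. For every integer $c\ge 0$ there exists an lsd-first Fibonacci DFAO generating the shifted sequence $(f(i+c))_{i\ge 0}$ with $O(\log c)$ states (that is, there is an absolute constant $K$ such that for all $c\ge 2$ the DFAO can be chosen with at most $K\log c$ states).
   Context: Fibonacci numbers: $F_0=0$, $F_1=1$, $F_i=F_{i-1}+F_{i-2}$ for $i\ge 2$. Zeckendorf representation: every integer $n\ge 0$ is uniquely written as $n=\sum_{2\le i\le t}a_iF_i$ with $a_i\in\{0,1\}$ and no two consecutive $a_i$ equal to $1$. The msd-first (most-significant-digit-first) representation is the word $(n)_F=a_ta_{t-1}\cdots a_2$; the lsd-first (least-significant-digit-first) representation is $a_2a_3\cdots a_t$. A binary word is a valid representation iff it does not contain $11$. Fibonacci word: $\mathbf{f}=f(0)f(1)f(2)\cdots=01001010\cdots$ is the infinite fixed point, starting with $0$, of the morphism $0\mapsto 01$, $1\mapsto 0$; equivalently $f(i)$ is the last (least significant) digit $a_2$ of the Zeckendorf representation of $i$. DFAO: a deterministic finite automaton with output is a 6-tuple $M=(Q,\Sigma,\delta,q_0,\Delta,\tau)$, with $Q$ a finite nonempty set of states, $\Sigma$ the input alphabet (here $\{0,1\}$), $\delta$ the transition function on $Q\times\Sigma$, extended to $Q\times\Sigma^*$ in the usual way, $q_0$ the initial state, $\Delta$ a finite nonempty output alphabet (here $\{0,1\}$), and $\tau:Q\to\Delta$ the output function. Convention: inputs that are not valid Zeckendorf representations (those containing $11$) do not reach any state and produce no output (so $\delta$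 is partial). An lsd-first Fibonacci DFAO generates a sequence $(a(i))_{i\ge0}$ if, for every $i\ge 0$, on reading the lsd-first Zeckendorf representation of $i$, followed by any number of trailing zeros, it reaches a state $q$ with $\tau(q)=a(i)$. *)

theory Defs
  imports Complex_Main "HOL-Number_Theory.Fib" "HOL-Library.Sublist"
begin

section \<open>Zeckendorf representations\<close>

definition zeck_valid :: "nat list \<Rightarrow> bool" where
  "zeck_valid w \<longleftrightarrow> set w \<subseteq> {0, 1} \<and> \<not> sublist [1, 1] w"

text \<open>Words are read with the least significant digit first: the digit at position \<open>i\<close>
  of the list has weight \<open>fib (i + 2)\<close>.\<close>

definition lsd_value :: "nat list \<Rightarrow> nat" where
  "lsd_value w = (\<Sum>i<length w. w ! i * fib (i + 2))"

text \<open>The canonical representation has no superfluous zeros at its most significant end,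
  so that \<open>0\<close> is represented by the empty word.\<close>

definition is_zeckendorf_lsd :: "nat \<Rightarrow> nat list \<Rightarrow> bool" where
  "is_zeckendorf_lsd n w \<longleftrightarrow>
     zeck_valid w \<and> lsd_value w = n \<and> (w = [] \<or> last w = 1)"

definition zeckendorf_lsd :: "nat \<Rightarrow> nat list" where
  "zeckendorf_lsd n = (THE w. is_zeckendorf_lsd n w)"

lemma lsd_value_Nil [simp]: "lsd_value [] = 0"
  by (simp add: lsd_value_def)

lemma lsd_value_snoc: "lsd_value (w @ [a]) = lsd_value w + a * fib (length w + 2)"
  by (simp add: lsd_value_def nth_append)

lemma zeck_valid_Nil [simp]: "zeck_valid []"
  by (simp add: zeck_valid_def)

lemma zeck_valid_appendD: "zeck_valid (u @ v) \<Longrightarrow> zeck_valid u"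
  by (auto simp: zeck_valid_def sublist_append)

lemma zeck_valid_snoc:
  "zeck_valid (w @ [a]) \<longleftrightarrow>
     zeck_valid w \<and> (a = 0 \<or> a = 1 \<and> (w = [] \<or> last w = 0))"
proof (cases w rule: rev_cases)
  case Nil
  then show ?thesis by (auto simp: zeck_valid_def sublist_Cons_right)
next
  case (snoc v b)
  have *: "sublist [1, 1] ((v @ [b]) @ [a]) \<longleftrightarrow>
      a = 1 \<and> b = 1 \<or> sublist [1, 1] (v @ [b])"
    using snoc_sublist_snoc[of "[1]" 1 "v @ [b]" a]
      by (auto simp: suffix_def)
  show ?thesis
    unfolding zeck_valid_def snoc * by auto
qed

lemma lsd_value_less: "zeck_valid w \<Longrightarrow> lsd_value w < fib (length w + 2)"
proof (induction w rule: length_induct)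
  case (1 w)
  show ?case
  proof (cases w rule: rev_cases)
    case Nil
    then show ?thesis by simp
  next
    case (snoc u a)
    have u: "zeck_valid u" and a: "a = 0 \<or> a = 1 \<and> (u = [] \<or> last u = 0)"
      using 1 snoc by (auto simp: zeck_valid_snoc)
    have IHu: "lsd_value u < fib (length u + 2)"
      using 1 snoc u by simp
    show ?thesis
    proof (cases "a = 0")
      case True
      have "fib (length u + 2) \<le> fib (length u + 3)"
        by (rule fib_mono) simp
      then show ?thesis
        using True IHu snoc by (simp add: lsd_value_snoc numeral_eq_Suc)
    next
      case False
      show ?thesis
      proof (cases u rule: rev_cases)
        case Nil
        then show ?thesis using False a snoc
          by (simp add: lsd_value_def numeral_eq_Suc)
      next
        case (snoc v b)
        then have b: "b = 0" "a = 1" using a False by auto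
        have "zeck_valid v" using u snoc by (simp add: zeck_valid_snoc)
        then have "lsd_value v < fib (length v + 2)"
          using 1 snoc \<open>w = u @ [a]\<close> by simp
        then show ?thesis
          using snoc \<open>w = u @ [a]\<close> b lsd_value_snoc[of "v @ [0]" 1] lsd_value_snoc[of v 0]
          by (simp add: numeral_eq_Suc)
      qed
    qed
  qed
qed

lemma lsd_value_inj:
  assumes "zeck_valid v" "zeck_valid w" "length v = length w" "lsd_value v = lsd_value w"
  shows "v = w"
  using assms
proof (induction v arbitrary: w rule: rev_induct)
  case Nil
  then show ?case by simp
next
  case (snoc a v)
  obtain u b where w: "w = u @ [b]"
    using snoc.prems(3) by (cases w rule: rev_cases) auto
  have v1: "zeck_valid v" and u1: "zeck_valid u" and ab: "a \<le> 1" "b \<le> 1"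
    using snoc.prems w by (auto simp: zeck_valid_snoc)
  have len: "length v = length u" using snoc.prems w by simp
  have eq: "lsd_value v + a * fib (length u + 2) = lsd_value u + b * fib (length u + 2)"
    using snoc.prems w len by (simp add: lsd_value_snoc)
  have "lsd_value v < fib (length u + 2)" "lsd_value u < fib (length u + 2)"
    using lsd_value_less v1 u1 len by metis+
  then have "a = b" using eq ab by (cases a; cases b) auto
  then show ?case using snoc.IH[OF v1 u1 len] eq w by simp
qed

theorem zeckendorf_exists_unique: "\<exists>!w. is_zeckendorf_lsd n w"
proof (rule ex_ex1I)
  have less_fib: "i < fib (i + 2)" for i
  proof (induction i)
    case (Suc i)
    have "fib (Suc i) > 0" by (rule fib_neq_0_nat) simp
    with Suc show ?case by simp
  qed simp
  have pad: "\<exists>w. length w = k \<and> zeck_valid w \<and> lsd_value w = n" if "n < fib (k + 2)" for k n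
    using that
  proof (induction k arbitrary: n rule: less_induct)
    case (less k)
    show ?case
    proof (cases k)
      case 0
      then show ?thesis using less.prems by simp
    next
      case (Suc j)
      show ?thesis
      proof (cases "n < fib (j + 2)")
        case True
        then obtain w where "length w = j" "zeck_valid w" "lsd_value w = n"
          using less.IH[of j n] Suc by auto
        then show ?thesis
          using Suc by (intro exI[of _ "w @ [0]"]) (simp add: zeck_valid_snoc lsd_value_snoc)
      next
        case False
        show ?thesis
        proof (cases j)
          case 0
          then have "n = 1" using False less.prems Suc by (simp add: numeral_eq_Suc)
          moreover have "zeck_valid [1]" using zeck_valid_snoc[of "[]" 1] by simp
          moreover have "lsd_value [1] = 1" using lsd_value_snoc[of "[]" 1] by simp
          ultimately show ?thesis
            using 0 Suc by (intro exI[of _ "[1]"]) simp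
        next
          case (Suc i)
          have "n - fib (j + 2) < fib (i + 2)"
            using less.prems False Suc \<open>k = Suc j\<close> by (simp add: numeral_eq_Suc)
          then obtain w where w: "length w = i" "zeck_valid w" "lsd_value w = n - fib (j + 2)"
            using less.IH[of i] Suc \<open>k = Suc j\<close> by auto
          have "zeck_valid ((w @ [0]) @ [1])"
            unfolding zeck_valid_snoc using w by simp
          moreover have "lsd_value ((w @ [0]) @ [1]) = n"
            unfolding lsd_value_snoc using w False Suc by simp
          ultimately show ?thesis
            using w Suc \<open>k = Suc j\<close> by (intro exI[of _ "(w @ [0]) @ [1]"]) simp
        qed
      qed
    qed
  qed
  have strip: "\<exists>v. is_zeckendorf_lsd (lsd_value w) v" if "zeck_valid w" for w
    using that
  proof (induction w rule: rev_induct)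
    case Nil
    then show ?case by (intro exI[of _ "[]"]) (simp add: is_zeckendorf_lsd_def)
  next
    case (snoc a w)
    show ?case
    proof (cases "a = 0")
      case True
      then show ?thesis using snoc by (simp add: zeck_valid_snoc lsd_value_snoc)
    next
      case False
      then have "a = 1" using snoc.prems by (simp add: zeck_valid_snoc)
      then show ?thesis
        using snoc.prems by (intro exI[of _ "w @ [a]"]) (simp add: is_zeckendorf_lsd_def)
    qed
  qed
  show "\<exists>w. is_zeckendorf_lsd n w"
    using pad[OF less_fib[of n]] strip by metis
next
  have le: "length v \<le> length w"
    if v: "is_zeckendorf_lsd n v" and w: "is_zeckendorf_lsd n w" for v w
  proof (cases v rule: rev_cases)
    case (snoc u a)
    then have "fib (length u + 2) \<le> n"
      using v by (auto simp: is_zeckendorf_lsd_def lsd_value_snoc)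
    moreover have "n < fib (length w + 2)"
      using w lsd_value_less by (auto simp: is_zeckendorf_lsd_def)
    ultimately have "\<not> length w + 2 \<le> length u + 2"
      using fib_mono[of "length w + 2" "length u + 2"] by linarith
    then show ?thesis using snoc by simp
  qed simp
  fix v w
  assume "is_zeckendorf_lsd n v" "is_zeckendorf_lsd n w"
  moreover from this have "length v = length w"
    using le by (meson le_antisym)
  ultimately show "v = w"
    using lsd_value_inj by (auto simp: is_zeckendorf_lsd_def)
qed

lemma is_zeckendorf_zeckendorf_lsd: "is_zeckendorf_lsd n (zeckendorf_lsd n)"
  unfolding zeckendorf_lsd_def by (rule theI') (rule zeckendorf_exists_unique)


section \<open>The Fibonacci word\<close>

definition fib_morphism :: "nat \<Rightarrow> nat list" where
  "fib_morphism a = (if a = 0 then [0, 1] else [0])"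

definition morph_ext :: "('a \<Rightarrow> 'b list) \<Rightarrow> 'a list \<Rightarrow> 'b list" where
  "morph_ext \<phi> w = concat (map \<phi> w)"

text \<open>The iterates of the morphism on \<open>[0]\<close> are prefixes of one another, and the \<open>i\<close>-th
  iterate has length \<open>fib (i + 2) > i\<close>.\<close>

definition fib_word :: "nat \<Rightarrow> nat" where
  "fib_word i = ((morph_ext fib_morphism ^^ i) [0]) ! i"

text \<open>An infinite word is a fixed point of a nonerasing morphism iff the image of each of its
  finite prefixes is again a prefix of it.\<close>

definition fixed_word :: "('a \<Rightarrow> 'a list) \<Rightarrow> (nat \<Rightarrow> 'a) \<Rightarrow> bool" where
  "fixed_word \<phi> x \<longleftrightarrow>
     (\<forall>n. \<exists>m. morph_ext \<phi> (map x [0..<n]) = map x [0..<m])"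

lemma morph_ext_append: "morph_ext \<phi> (v @ w) = morph_ext \<phi> v @ morph_ext \<phi> w"
  by (simp add: morph_ext_def)

lemma fib_iterate_rec:
  "(morph_ext fib_morphism ^^ Suc (Suc n)) [0] =
     (morph_ext fib_morphism ^^ Suc n) [0] @ (morph_ext fib_morphism ^^ n) [0]"
proof (induction n)
  case 0
  then show ?case by (simp add: morph_ext_def fib_morphism_def)
next
  case (Suc n)
  have "(morph_ext fib_morphism ^^ Suc (Suc (Suc n))) [0]
      = morph_ext fib_morphism ((morph_ext fib_morphism ^^ Suc (Suc n)) [0])"
    by simp
  also have "\<dots> = morph_ext fib_morphism ((morph_ext fib_morphism ^^ Suc n) [0]) @
      morph_ext fib_morphism ((morph_ext fib_morphism ^^ n) [0])"
    by (simp only: Suc.IH morph_ext_append)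
  finally show ?case by simp
qed

lemma length_fib_iterate: "length ((morph_ext fib_morphism ^^ n) [0]) = fib (n + 2)"
proof (induction n rule: fib.induct)
  case 2
  then show ?case by (simp add: morph_ext_def fib_morphism_def)
next
  case (3 n)
  then show ?case unfolding fib_iterate_rec by simp
qed simp

lemma prefix_fib_iterate:
  "m \<le> n \<Longrightarrow>
     prefix ((morph_ext fib_morphism ^^ m) [0]) ((morph_ext fib_morphism ^^ n) [0])"
proof (induction n rule: dec_induct)
  case (step n)
  have "prefix ((morph_ext fib_morphism ^^ n) [0]) ((morph_ext fib_morphism ^^ Suc n) [0])"
  proof (cases n)
    case 0
    then show ?thesis by (simp add: morph_ext_def fib_morphism_def)
  next
    case (Suc k)
    show ?thesis unfolding Suc fib_iterate_rec by simp
  qed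
  with step.IH show ?case by (rule prefix_order.trans)
qed simp

lemma less_length_fib_iterate: "i < length ((morph_ext fib_morphism ^^ i) [0])"
proof -
  have "i < fib (i + 2)"
  proof (induction i)
    case (Suc i)
    have "fib (Suc i) > 0" by (rule fib_neq_0_nat) simp
    with Suc show ?case by simp
  qed simp
  then show ?thesis by (simp add: length_fib_iterate)
qed

lemma fib_word_eq_nth:
  assumes "i < length ((morph_ext fib_morphism ^^ n) [0])"
  shows "fib_word i = ((morph_ext fib_morphism ^^ n) [0]) ! i"
proof -
  let ?X = "\<lambda>n. (morph_ext fib_morphism ^^ n) [0]"
  have "prefix (?X i) (?X n) \<or> prefix (?X n) (?X i)"
    using prefix_fib_iterate nat_le_linear by blast
  then show ?thesis
    unfolding fib_word_def
    using assms less_length_fib_iterate[of i] by (auto simp: prefix_def nth_append)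
qed

theorem fib_word_unique: "x 0 = 0 \<and> fixed_word fib_morphism x \<longleftrightarrow> x = fib_word"
proof
  assume x: "x 0 = 0 \<and> fixed_word fib_morphism x"
  have X: "\<exists>m. (morph_ext fib_morphism ^^ n) [0] = map x [0..<m]" for n
  proof (induction n)
    case 0
    show ?case using x by (intro exI[of _ 1]) simp
  next
    case (Suc n)
    then show ?case using x by (auto simp: fixed_word_def)
  qed
  show "x = fib_word"
  proof
    fix i
    obtain m where m: "(morph_ext fib_morphism ^^ i) [0] = map x [0..<m]" using X by blast
    then have "i < m" using less_length_fib_iterate[of i] by simp
    then show "x i = fib_word i" unfolding fib_word_def m by simp
  qed
next
  assume "x = fib_word"
  let ?X = "\<lambda>n. (morph_ext fib_morphism ^^ n) [0]"
  have pre: "take n (?X k) = map fib_word [0..<n]" if "n \<le> length (?X k)" for n k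
    using that fib_word_eq_nth[of _ k] by (intro nth_equalityI) auto
  have "\<exists>m. morph_ext fib_morphism (map fib_word [0..<n]) = map fib_word [0..<m]" for n
  proof -
    let ?w = "morph_ext fib_morphism (map fib_word [0..<n])"
    have "?X (Suc n) = morph_ext fib_morphism (take n (?X n) @ drop n (?X n))"
      by simp
    also have "\<dots> = ?w @ morph_ext fib_morphism (drop n (?X n))"
      unfolding morph_ext_append using pre[of n n] less_length_fib_iterate[of n] by simp
    finally have X: "?X (Suc n) = ?w @ morph_ext fib_morphism (drop n (?X n))" .
    have "?w = take (length ?w) (?X (Suc n))" unfolding X by simp
    also have "\<dots> = map fib_word [0..<length ?w]"
      by (rule pre) (simp only: X length_append le_add1)
    finally show ?thesis by blast
  qed
  then show "x 0 = 0 \<and> fixed_word fib_morphism x"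
    using \<open>x = fib_word\<close> by (simp add: fixed_word_def fib_word_def)
qed


section \<open>Automata with output\<close>

text \<open>The transition function is partial; \<open>None\<close> means that no state is reached.\<close>

record ('q, 'a, 'b) dfao =
  states :: "'q set"
  alphabet :: "'a set"
  step :: "'q \<Rightarrow> 'a \<Rightarrow> 'q option"
  initial :: 'q
  out_alphabet :: "'b set"
  out :: "'q \<Rightarrow> 'b"

definition wf_dfao :: "('q, 'a, 'b) dfao \<Rightarrow> bool" where
  "wf_dfao M \<longleftrightarrow>
     finite (states M) \<and> initial M \<in> states M \<and>
     finite (alphabet M) \<and>
     finite (out_alphabet M) \<and> out_alphabet M \<noteq> {} \<and>
     (\<forall>q\<in>states M. \<forall>a\<in>alphabet M. \<forall>q'. step M q a = Some q' \<longrightarrow> q' \<in> states M) \<and>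
     (\<forall>q\<in>states M. out M q \<in> out_alphabet M)"

fun run :: "('q, 'a, 'b) dfao \<Rightarrow> 'q \<Rightarrow> 'a list \<Rightarrow> 'q option" where
  "run M q [] = Some q"
| "run M q (a # w) = (case step M q a of None \<Rightarrow> None | Some q' \<Rightarrow> run M q' w)"

definition fibonacci_dfao :: "('q, nat, nat) dfao \<Rightarrow> bool" where
  "fibonacci_dfao M \<longleftrightarrow>
     wf_dfao M \<and> alphabet M = {0, 1} \<and> out_alphabet M = {0, 1} \<and>
     (\<forall>w. set w \<subseteq> {0, 1} \<and> \<not> zeck_valid w \<longrightarrow> run M (initial M) w = None)"

definition lsd_generates :: "('q, nat, nat) dfao \<Rightarrow> (nat \<Rightarrow> nat) \<Rightarrow> bool" where
  "lsd_generates M a \<longleftrightarrow>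
     (\<forall>i k. \<exists>q. run M (initial M) (zeckendorf_lsd i @ replicate k 0) = Some q \<and> out M q = a i)"

end

theory Submission
  imports Defs
begin

text \<open>Let \<open>\<psi>\<close> be the conjugate of the golden ratio \<open>\<phi>\<close>. Evaluating a Zeckendorf word at \<open>\<psi>\<close>
  maps \<open>m\<close> to a representative of \<open>- \<phi> m\<close> modulo 1 in an interval of length 1, and the first
  digit of the word tells on which side of \<open>- \<psi>\<^sup>3\<close> this representative lies. Hence
  \<open>f (i + c)\<close> depends only on the position of the sum of the values for \<open>i\<close> and \<open>c\<close> relative to
  the thresholds \<open>- \<psi>\<close>, \<open>- \<psi>\<^sup>2\<close> and \<open>- \<psi>\<^sup>3\<close>. A prefix of length \<open>t\<close> of the word of \<open>i\<close> fixes
  that sum up to an error below \<open>\<bar>\<psi>\<bar>\<^sup>t\<close>; either the output is then decided, or the offset from a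
  threshold, scaled by \<open>\<psi>\<^sup>-\<^sup>t\<close>, is at most 1. Scaled offsets for the same \<open>t\<close> and threshold
  differ by elements of \<open>\<int>[\<phi>]\<close> that are bounded together with their conjugates, so there are
  boundedly many of them, and once \<open>t\<close> reaches the length of the representation of \<open>c\<close> the
  offsets themselves have this property. So there are \<open>O(log c)\<close> Myhill-Nerode classes.\<close>

section \<open>Validity of words\<close>

lemma zeck_valid_append:
  "zeck_valid (u @ v) \<longleftrightarrow>
     zeck_valid u \<and> zeck_valid v \<and> \<not> (u \<noteq> [] \<and> v \<noteq> [] \<and> last u = 1 \<and> hd v = 1)"
proof (induction v rule: rev_induct)
  case Nil
  then show ?case by simp
next
  case (snoc a v)
  have "zeck_valid (u @ v @ [a]) \<longleftrightarrow>
      zeck_valid (u @ v) \<and> (a = 0 \<or> a = 1 \<and> (u @ v = [] \<or> last (u @ v) = 0))"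
    using zeck_valid_snoc[of "u @ v" a] by simp
  moreover have "last u = 0 \<or> last u = 1" if "zeck_valid u" "u \<noteq> []"
    using that last_in_set[of u] unfolding zeck_valid_def by blast
  ultimately show ?case
    unfolding snoc.IH zeck_valid_snoc by (cases v) auto
qed

lemma zeck_valid_Cons:
  "zeck_valid (a # w) \<longleftrightarrow> a \<in> {0, 1} \<and> zeck_valid w \<and> \<not> (a = 1 \<and> w \<noteq> [] \<and> hd w = 1)"
  using zeck_valid_append[of "[a]" w] zeck_valid_snoc[of "[]" a] by auto

lemma zeck_valid_replicate_0: "zeck_valid (replicate k 0)"
  by (induction k) (auto simp: zeck_valid_Cons)

lemma lsd_value_append_zeros: "lsd_value (w @ replicate k 0) = lsd_value w"
proof (induction k)
  case (Suc k)
  then show ?case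
    using lsd_value_snoc[of "w @ replicate k 0" 0] by (simp add: replicate_append_same)
qed simp

section \<open>Automata from residuals\<close>

text \<open>Myhill-Nerode residual: prefixes with equal residuals may share a state.
  \<open>None\<close> marks the continuations that make the word invalid.\<close>

definition zeck_residual :: "(nat list \<Rightarrow> nat) \<Rightarrow> nat list \<Rightarrow> nat list \<Rightarrow> nat option" where
  "zeck_residual g w = (\<lambda>v. if zeck_valid (w @ v) then Some (g (w @ v)) else None)"

text \<open>The residuals serve as states: reading \<open>a\<close> turns \<open>r\<close> into
  \<open>\<lambda>v. r (a # v)\<close>, and the output is the value at the empty word. The bijection
  \<open>h\<close> renames residuals to natural numbers.\<close>

lemma dfao_of_zeck_residuals:
  fixes g :: "nat list \<Rightarrow> nat"
  assumes fin: "finite (zeck_residual g ` {w. zeck_valid w})"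
    and g: "\<And>w. g w \<in> {0, 1}"
  obtains M :: "(nat, nat, nat) dfao" where
    "fibonacci_dfao M" "card (states M) = card (zeck_residual g ` {w. zeck_valid w})"
    "\<And>w. zeck_valid w \<Longrightarrow> \<exists>q. run M (initial M) w = Some q \<and> out M q = g w"
proof -
  define S where "S = zeck_residual g ` {w. zeck_valid w}"
  obtain h where h: "bij_betw h S {0..<card S}"
    using ex_bij_betw_finite_nat[of S] fin S_def by blast
  let ?h' = "inv_into S h"
  have h': "?h' (h q) = q" if "q \<in> S" for q
    using h that by (simp add: bij_betw_inv_into_left)
  have h'_S: "\<exists>w. zeck_valid w \<and> i = h (zeck_residual g w)" if "i < card S" for i
    proof -
    have "i \<in> h ` S" using bij_betw_imp_surj_on[OF h] that by simp
    then show ?thesis unfolding S_def by blast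
  qed
  have hS: "h (zeck_residual g w) < card S" if "zeck_valid w" for w
    using bij_betwE[OF h] that unfolding S_def by simp
  \<comment> \<open>Prefixes of valid words are valid, so \<open>None\<close> at \<open>[a]\<close>
    already means that no continuation through \<open>a\<close> is valid.\<close>
  define M :: "(nat, nat, nat) dfao" where
    "M = \<lparr>states = {0..<card S}, alphabet = {0, 1},
      step = (\<lambda>i a. if ?h' i [a] = None then None else Some (h (\<lambda>v. ?h' i (a # v)))),
      initial = h (zeck_residual g []), out_alphabet = {0, 1},
      out = (\<lambda>i. the (?h' i []))\<rparr>"
  have step: "step M (h (zeck_residual g w)) a =
      (if zeck_valid (w @ [a]) then Some (h (zeck_residual g (w @ [a]))) else None)"
    if "zeck_valid w" for w a
    using that h'[of "zeck_residual g w"]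
    by (simp add: M_def S_def) (simp add: zeck_residual_def cong: if_cong)
  have out: "out M (h (zeck_residual g w)) = g w" if "zeck_valid w" for w
    using that h'[of "zeck_residual g w"]
    by (simp add: M_def S_def) (simp add: zeck_residual_def)
  have run: "run M (h (zeck_residual g w)) v =
      (if zeck_valid (w @ v) then Some (h (zeck_residual g (w @ v))) else None)"
    if "zeck_valid w" for w v
    using that
  proof (induction v arbitrary: w)
    case (Cons a v)
    then show ?case
      using step[of w a] Cons.IH[of "w @ [a]"] zeck_valid_appendD[of "w @ [a]" v] by auto
  qed simp
  have run0: "run M (initial M) v = (if zeck_valid v then Some (h (zeck_residual g v)) else None)"
    for v using run[of "[]" v] by (simp add: M_def)
  have "wf_dfao M"
    unfolding wf_dfao_def
  proof (intro conjI ballI allI impI)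
    fix q a q' assume "q \<in> states M" "step M q a = Some q'"
    then obtain w where "zeck_valid w" "step M (h (zeck_residual g w)) a = Some q'"
      using h'_S[of q] by (auto simp: M_def)
    then show "q' \<in> states M"
      using step[of w a] hS[of "w @ [a]"] by (auto simp: M_def split: if_splits)
  next
    fix q assume "q \<in> states M"
    then obtain w where "zeck_valid w" "q = h (zeck_residual g w)"
      using h'_S[of q] by (auto simp: M_def)
    then show "out M q \<in> out_alphabet M"
      using out[of w] g[of w] by (simp add: M_def)
  qed (use hS[of "[]"] in \<open>auto simp: M_def\<close>)
  then have "fibonacci_dfao M"
    using run0 by (auto simp: fibonacci_dfao_def M_def)
  moreover have "card (states M) = card (zeck_residual g ` {w. zeck_valid w})"
    by (simp add: M_def S_def)
  moreover have "\<exists>q. run M (initial M) w = Some q \<and> out M q = g w" if "zeck_valid w" for w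
    using that run0 out by simp
  ultimately show ?thesis using that by blast
qed

section \<open>The golden ratio\<close>

definition golden :: real where "golden = (1 + sqrt 5) / 2"

definition golden_conj :: real where "golden_conj = (1 - sqrt 5) / 2"

lemma golden_eq: "golden = 1 - golden_conj"
  by (simp add: golden_def golden_conj_def field_simps)

lemma golden_conj_sq: "golden_conj * golden_conj = golden_conj + 1"
  by (simp add: golden_conj_def field_simps)

lemma golden_sq: "golden * golden = golden + 1"
  by (simp add: golden_def field_simps)

lemma golden_times_conj: "golden * golden_conj = -1"
  by (simp add: golden_def golden_conj_def field_simps)

text \<open>Powers of \<open>golden_conj\<close> up to the fourth reduce to linear expressions in
  it, so this enclosure settles the comparisons between thresholds.\<close>

lemma golden_conj_bounds: "- 31 / 50 < golden_conj" "golden_conj < - 61 / 100"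
proof -
  have "sqrt 5 < 2.24" by (rule real_less_lsqrt) (auto simp: power2_eq_square)
  moreover have "2.22 < sqrt 5" by (rule real_less_rsqrt) (auto simp: power2_eq_square)
  ultimately show "- 31 / 50 < golden_conj" "golden_conj < - 61 / 100"
    by (auto simp: golden_conj_def)
qed

lemma golden_bounds: "161 / 100 < golden" "golden < 81 / 50"
  using golden_conj_bounds by (auto simp: golden_eq)

lemma golden_conj_pow2: "golden_conj ^ 2 = golden_conj + 1"
  by (simp add: power2_eq_square golden_conj_sq)

lemma golden_conj_pow3: "golden_conj ^ 3 = 2 * golden_conj + 1"
  by (simp add: power3_eq_cube golden_conj_sq algebra_simps)

lemma golden_conj_pow4: "golden_conj ^ 4 = 3 * golden_conj + 2"
proof -
  have "golden_conj ^ 4 = golden_conj * golden_conj ^ 3"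
    by (simp add: numeral_eq_Suc)
  then have "golden_conj ^ 4 = 2 * (golden_conj * golden_conj) + golden_conj"
    by (simp add: golden_conj_pow3 algebra_simps)
  then show ?thesis by (simp add: golden_conj_sq)
qed

text \<open>Modulo 1 the power is \<open>- golden * fib n\<close>; this is why evaluating a word at
  \<open>golden_conj\<close> yields \<open>- golden\<close> times its value modulo 1.\<close>

lemma golden_conj_power_fib: "golden_conj ^ n = fib (Suc n) - golden * fib n"
proof (induction n)
  case (Suc n)
  have "golden_conj ^ Suc n = golden_conj * fib (Suc n) - (golden * golden_conj) * fib n"
    by (simp add: Suc right_diff_distrib)
  then show ?case by (simp add: golden_times_conj) (simp add: golden_eq algebra_simps)
qed simp

text \<open>\<open>x\<close> is an element of \<int>[\<phi>] and \<open>y\<close> is its Galois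
  conjugate.\<close>

definition golden_pair :: "real \<Rightarrow> real \<Rightarrow> bool" where
  "golden_pair x y \<longleftrightarrow>
     (\<exists>a b :: int. x = of_int a + of_int b * golden_conj \<and> y = of_int a + of_int b * golden)"

lemma golden_pair_of_int: "golden_pair (of_int a) (of_int a)"
  unfolding golden_pair_def by (rule exI[of _ a], rule exI[of _ 0]) simp

lemma golden_pair_add:
  assumes "golden_pair x y" "golden_pair x' y'"
  shows "golden_pair (x + x') (y + y')"
proof -
  obtain a b a' b' :: int where
    "x = of_int a + of_int b * golden_conj" "y = of_int a + of_int b * golden"
    "x' = of_int a' + of_int b' * golden_conj" "y' = of_int a' + of_int b' * golden"
    using assms unfolding golden_pair_def by blast
  then show ?thesis
    unfolding golden_pair_def
    by (intro exI[of _ "a + a'"] exI[of _ "b + b'"]) (simp add: algebra_simps)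
qed

lemma golden_pair_mult:
  assumes "golden_pair x y" "golden_pair x' y'"
  shows "golden_pair (x * x') (y * y')"
proof -
  obtain a b a' b' :: int where e:
    "x = of_int a + of_int b * golden_conj" "y = of_int a + of_int b * golden"
    "x' = of_int a' + of_int b' * golden_conj" "y' = of_int a' + of_int b' * golden"
    using assms unfolding golden_pair_def by blast
  \<comment> \<open>\<phi> and \<psi> are both roots of \<open>r * r = r + 1\<close>, so one
    coefficient formula serves both components.\<close>
  have *: "(of_int a + of_int b * r) * (of_int a' + of_int b' * r) =
      of_int (a * a' + b * b') + of_int (a * b' + a' * b + b * b') * r"
    if "r * r = r + 1" for r :: real
  proof -
    have "(of_int a + of_int b * r) * (of_int a' + of_int b' * r) =
        of_int a * of_int a' + of_int a * of_int b' * r + of_int b * of_int a' * r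
        + of_int b * of_int b' * (r * r)"
      by (simp add: algebra_simps)
    then show ?thesis unfolding that by (simp add: algebra_simps)
  qed
  show ?thesis
    unfolding golden_pair_def e using *[OF golden_conj_sq] *[OF golden_sq] by blast
qed

lemma golden_pair_conj: "golden_pair golden_conj golden"
  unfolding golden_pair_def by (rule exI[of _ 0], rule exI[of _ 1]) simp

lemma golden_pair_uminus: "golden_pair x y \<Longrightarrow> golden_pair (- x) (- y)"
  using golden_pair_mult[OF golden_pair_of_int[of "-1"]] by simp

lemma golden_pair_diff:
  "golden_pair x y \<Longrightarrow> golden_pair x' y' \<Longrightarrow> golden_pair (x - x') (y - y')"
  using golden_pair_add[OF _ golden_pair_uminus] by simp

lemma golden_pair_power: "golden_pair x y \<Longrightarrow> golden_pair (x ^ n) (y ^ n)"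
  using golden_pair_of_int[of 1] by (induction n) (auto intro: golden_pair_mult)

text \<open>\<phi> and \<psi> are units of \<int>[\<phi>]: each is minus the inverse of the
  other.\<close>

lemma golden_pair_divide_power:
  assumes "golden_pair x y"
  shows "golden_pair (x / golden_conj ^ n) (y / golden ^ n)"
proof -
  have "inverse golden_conj = - golden" "inverse golden = - golden_conj"
    using golden_times_conj by (auto intro!: inverse_unique simp: mult.commute)
  moreover have "golden_pair (- golden) (- golden_conj)"
    using golden_pair_diff[OF golden_pair_conj golden_pair_of_int[of 1]]
    by (simp add: golden_eq)
  ultimately show ?thesis
    using golden_pair_mult[OF assms golden_pair_power[of "- golden" "- golden_conj" n]]
    by (simp add: divide_inverse flip: power_inverse)
qed

text \<open>2 bounds the difference of two scaled offsets; 15 = 3 * 5 bounds three conjugates, each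
  at most \<open>golden ^ 3 \<le> 5\<close> after scaling.\<close>

definition golden_box :: "real set" where
  "golden_box = {x. \<exists>y. golden_pair x y \<and> \<bar>x\<bar> \<le> 2 \<and> \<bar>y\<bar> \<le> 15}"

lemma golden_boxI: "golden_pair x y \<Longrightarrow> \<bar>x\<bar> \<le> 2 \<Longrightarrow> \<bar>y\<bar> \<le> 15 \<Longrightarrow> x \<in> golden_box"
  unfolding golden_box_def by blast

text \<open>An element and its conjugate differ by \<open>b\<close> times
  \<open>golden - golden_conj\<close>, which exceeds 1; this bounds \<open>b\<close> by 17 and then
  \<open>a\<close> by 19.\<close>

lemma finite_golden_box: "finite golden_box"
proof (rule finite_subset)
  show "golden_box \<subseteq>
      (\<lambda>(a, b). of_int a + of_int b * golden_conj) ` ({-40..40} \<times> {-20..20::int})"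
  proof
    fix x assume "x \<in> golden_box"
    then obtain a b :: int where x: "x = of_int a + of_int b * golden_conj"
      and y: "\<bar>of_int a + of_int b * golden\<bar> \<le> 15" and x2: "\<bar>x\<bar> \<le> 2"
      unfolding golden_box_def golden_pair_def by blast
    have "\<bar>real_of_int b * (golden - golden_conj)\<bar> \<le> 17"
      using x y x2 by (simp add: algebra_simps)
    moreover have "\<bar>real_of_int b\<bar> * 1 \<le> \<bar>real_of_int b\<bar> * (golden - golden_conj)"
      using golden_bounds golden_conj_bounds by (intro mult_left_mono) auto
    ultimately have b: "\<bar>real_of_int b\<bar> \<le> 17"
      using golden_bounds golden_conj_bounds by (simp add: abs_mult)
    have "\<bar>real_of_int b * golden_conj\<bar> \<le> 17 * 1"
      unfolding abs_mult using b golden_conj_bounds by (intro mult_mono) auto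
    then have "\<bar>real_of_int a\<bar> \<le> 19" using x x2 by linarith
    then show "x \<in> (\<lambda>(a, b). of_int a + of_int b * golden_conj) `
        ({-40..40} \<times> {-20..20::int})"
      using b x by (intro image_eqI[of _ _ "(a, b)"]) auto
  qed
qed simp

section \<open>The conjugate of a word\<close>

text \<open>Horner form: the digit at position \<open>i\<close> has weight
  \<open>\<beta> ^ (i + 2)\<close>, parallel to \<open>fib (i + 2)\<close> in
  \<open>lsd_value\<close>.\<close>

primrec lsd_eval :: "real \<Rightarrow> nat list \<Rightarrow> real" where
  "lsd_eval \<beta> [] = 0"
| "lsd_eval \<beta> (a # w) = real a * \<beta>\<^sup>2 + \<beta> * lsd_eval \<beta> w"

lemma lsd_eval_append: "lsd_eval \<beta> (u @ v) = lsd_eval \<beta> u + \<beta> ^ length u * lsd_eval \<beta> v"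
  by (induction u) (auto simp: algebra_simps)

lemma golden_pair_lsd_eval: "golden_pair (lsd_eval golden_conj w) (lsd_eval golden w)"
proof (induction w)
  case (Cons a w)
  then show ?case
    using golden_pair_of_int[of "int a"]
    by (auto intro!: golden_pair_add golden_pair_mult golden_pair_power golden_pair_conj)
qed (use golden_pair_of_int[of 0] in simp)

lemma lsd_eval_golden_conj:
  "\<exists>p :: int. lsd_eval golden_conj w = of_int p - golden * lsd_value w"
proof (induction w rule: rev_induct)
  case Nil
  then show ?case by (intro exI[of _ 0]) simp
next
  case (snoc a w)
  then obtain p :: int where "lsd_eval golden_conj w = of_int p - golden * lsd_value w" by blast
  moreover have "golden_conj ^ length w * golden_conj\<^sup>2 =
      fib (length w + 3) - golden * fib (length w + 2)"
    using golden_conj_power_fib[of "length w + 2"]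
    by (simp add: power_add power2_eq_square numeral_eq_Suc mult.assoc mult.left_commute mult.commute)
  then have "golden_conj ^ length w * (real a * golden_conj\<^sup>2) =
      real a * (fib (length w + 3) - golden * fib (length w + 2))"
    by (metis mult.left_commute)
  ultimately show ?case
    by (intro exI[of _ "p + int a * int (fib (length w + 3))"])
      (simp add: lsd_eval_append lsd_value_snoc algebra_simps)
qed

text \<open>The bounds are the geometric series of the even and of the odd powers of the
  conjugate; the threshold separates the words by their first digit.\<close>

lemma lsd_eval_golden_conj_bounds:
  assumes "zeck_valid w"
  shows "- (golden_conj ^ 2) < lsd_eval golden_conj w \<and> lsd_eval golden_conj w < - golden_conj \<and>
    (if w \<noteq> [] \<and> hd w = 1 then - (golden_conj ^ 3) < lsd_eval golden_conj w
     else lsd_eval golden_conj w < - (golden_conj ^ 3))"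
  using assms
proof (induction w)
  case Nil
  then show ?case using golden_conj_bounds by (simp add: golden_conj_pow2 golden_conj_pow3)
next
  case (Cons a w)
  let ?r = golden_conj and ?s = "lsd_eval golden_conj w"
  note b = golden_conj_bounds
  have w: "zeck_valid w" and a: "a = 0 \<or> a = 1 \<and> \<not> (w \<noteq> [] \<and> hd w = 1)"
    using Cons.prems by (auto simp: zeck_valid_Cons)
  note IH = Cons.IH[OF w, unfolded golden_conj_pow2 golden_conj_pow3]
  \<comment> \<open>Multiplication by the negative \<psi> swaps bounds: (-\<psi>^2, -\<psi>) goes to
    (-\<psi>^2, -\<psi>^3), the claim for first digit 0.\<close>
  have neg: "?r * x < ?r * y" if "y < x" for x y
    using that b by simp
  have 1: "?r * ?s < ?r * (- (?r + 1))" "?r * (- ?r) < ?r * ?s"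
    by (rule neg; use IH in linarith)+
  show ?case
  proof (cases "a = 0")
    case True
    then show ?thesis
      using 1 b by (simp add: golden_conj_pow2 golden_conj_pow3 golden_conj_sq algebra_simps)
  next
    case False
    \<comment> \<open>After a 1 comes a 0 or the end, so the tail lies below -\<psi>^3; the lower
      bound becomes \<psi>^2 - \<psi>^4 = -\<psi>^3.\<close>
    then have "a = 1" and "?s < - (2 * ?r + 1)" using a IH by (auto split: if_splits)
    from neg[OF this(2)] have "- (2 * (?r * ?r) + ?r) < ?r * ?s"
      by (simp add: algebra_simps)
    then have "- (3 * ?r + 2) < ?r * ?s" by (simp add: golden_conj_sq)
    then show ?thesis
      using 1 b \<open>a = 1\<close>
      by (simp add: golden_conj_pow2 golden_conj_pow3 golden_conj_sq algebra_simps)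
  qed
qed

lemma abs_lsd_eval_golden_conj_less: "zeck_valid w \<Longrightarrow> \<bar>lsd_eval golden_conj w\<bar> < 1"
  using lsd_eval_golden_conj_bounds[of w] golden_conj_bounds
  by (auto simp: golden_conj_pow2)

lemma lsd_eval_golden_bounds:
  assumes "zeck_valid w"
  shows "0 \<le> lsd_eval golden w" "lsd_eval golden w \<le> golden ^ 3 * golden ^ length w"
proof -
  have g: "golden ^ 3 = golden + golden * golden"
    using golden_sq by (simp add: power3_eq_cube algebra_simps)
  \<comment> \<open>Geometric series of the weights, using 1 / (\<phi> - 1) = \<phi>; the subtracted
    1 lets the induction close.\<close>
  have "0 \<le> lsd_eval golden w \<and> lsd_eval golden w \<le> golden ^ 3 * (golden ^ length w - 1)"
    using assms
  proof (induction w)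
    case (Cons a w)
    have a: "a = 0 \<or> a = 1" and IH: "0 \<le> lsd_eval golden w"
      "lsd_eval golden w \<le> golden ^ 3 * (golden ^ length w - 1)"
      using Cons by (auto simp: zeck_valid_Cons)
    have "golden * lsd_eval golden w \<le> golden * (golden ^ 3 * (golden ^ length w - 1))"
      using IH golden_bounds by (intro mult_left_mono) auto
    moreover have "golden ^ 3 * golden = golden ^ 3 + golden ^ 2"
      using golden_sq by (simp add: power3_eq_cube power2_eq_square algebra_simps)
    moreover have "0 \<le> real a * golden\<^sup>2" "real a * golden\<^sup>2 \<le> golden\<^sup>2" using a by auto
    moreover have "0 \<le> golden * lsd_eval golden w" using IH golden_bounds by simp
    ultimately show ?case by (simp add: algebra_simps)
  qed simp
  moreover have "0 \<le> golden ^ 3" using golden_bounds by simp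
  ultimately show "0 \<le> lsd_eval golden w" "lsd_eval golden w \<le> golden ^ 3 * golden ^ length w"
    by (simp_all only: right_diff_distrib, linarith)
qed

section \<open>The shifted Fibonacci word\<close>

text \<open>The iterates satisfy X(n+2) = X(n+1) X(n). A top digit 1 moves the index past X(n+1),
  and the 0 before it keeps the remainder inside X(n), so dropping the top digit preserves the
  letter.\<close>

lemma fib_word_lsd_value:
  "zeck_valid w \<Longrightarrow> fib_word (lsd_value w) = (if w = [] then 0 else hd w)"
proof (induction w rule: rev_induct)
  case Nil
  then show ?case by (simp add: fib_word_def)
next
  case (snoc a w)
  have w: "zeck_valid w" and a: "a = 0 \<or> a = 1 \<and> (w = [] \<or> last w = 0)"
    using snoc.prems by (auto simp: zeck_valid_snoc)
  show ?case
  proof (cases "a = 0")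
    case True
    then show ?thesis using snoc.IH[OF w] by (simp add: lsd_value_snoc)
  next
    case False
    then have a1: "a = 1" using a by simp
    show ?thesis
    proof (cases w rule: rev_cases)
      case Nil
      then show ?thesis
        using a1 lsd_value_snoc[of "[]" 1]
        by (simp add: fib_word_def morph_ext_def fib_morphism_def)
    next
      case (snoc u b)
      let ?X = "\<lambda>n. (morph_ext fib_morphism ^^ n) [0]" and ?n = "length u"
      have b: "b = 0" "zeck_valid u" using snoc a a1 w by (auto simp: zeck_valid_snoc)
      have r: "lsd_value w < fib (?n + 2)"
        using lsd_value_less[OF b(2)] b snoc by (simp add: lsd_value_snoc)
      have v: "lsd_value (w @ [a]) = length (?X (Suc ?n)) + lsd_value w"
        unfolding length_fib_iterate lsd_value_snoc using snoc a1 by simp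
      have "fib_word (lsd_value (w @ [a])) = ?X (Suc (Suc ?n)) ! lsd_value (w @ [a])"
        using r v by (intro fib_word_eq_nth) (simp only: fib_iterate_rec length_append length_fib_iterate)
      also have "\<dots> = ?X ?n ! lsd_value w"
        unfolding v fib_iterate_rec by (rule nth_append_length_plus)
      also have "\<dots> = fib_word (lsd_value w)"
        using r by (intro fib_word_eq_nth[symmetric]) (simp only: length_fib_iterate)
      finally show ?thesis using snoc.IH[OF w] snoc by (cases u) simp_all
    qed
  qed
qed

lemma fib_word_binary: "fib_word n \<in> {0, 1}"
proof -
  have v: "zeck_valid (zeckendorf_lsd n)" "lsd_value (zeckendorf_lsd n) = n"
    using is_zeckendorf_zeckendorf_lsd[of n] by (auto simp: is_zeckendorf_lsd_def)
  then show ?thesis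
    using fib_word_lsd_value[OF v(1)] hd_in_set[of "zeckendorf_lsd n"]
    unfolding zeck_valid_def by (metis insertI1 subsetD)
qed

text \<open>Evaluations lie in (-\<psi>^2, -\<psi>), with first digit 1 above -\<psi>^3. A sum of
  two that is below -\<psi>^2 returns by +1 and lands above -\<psi>^3; one above -\<psi> returns by
  -1 and lands below it.\<close>

definition shift_window :: "real \<Rightarrow> bool" where
  "shift_window x \<longleftrightarrow>
     x < - (golden_conj ^ 2) \<or> - (golden_conj ^ 3) < x \<and> x < - (golden_conj ^ 1)"

text \<open>The conjugate of the representation of \<open>m\<close> is congruent to \<open>- golden * m\<close> modulo 1,
  hence additive modulo 1.\<close>

lemma fib_word_add:
  assumes "zeck_valid u" "zeck_valid v"
  shows "fib_word (lsd_value u + lsd_value v) =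
    of_bool (shift_window (lsd_eval golden_conj u + lsd_eval golden_conj v))"
proof -
  let ?s = "lsd_eval golden_conj"
  define w where "w = zeckendorf_lsd (lsd_value u + lsd_value v)"
  have w: "zeck_valid w" "lsd_value w = lsd_value u + lsd_value v"
    using is_zeckendorf_zeckendorf_lsd by (auto simp: is_zeckendorf_lsd_def w_def)
  obtain p q r :: int where
    "?s u = of_int p - golden * lsd_value u" "?s v = of_int q - golden * lsd_value v"
    "?s w = of_int r - golden * lsd_value w"
    using lsd_eval_golden_conj by meson
  then have "?s w = ?s u + ?s v + of_int (r - p - q)"
    using w by (simp add: algebra_simps)
  then obtain d :: int where eq: "?s w = ?s u + ?s v + of_int d" by blast
  note b = golden_conj_bounds
  note B = lsd_eval_golden_conj_bounds[unfolded golden_conj_pow2 golden_conj_pow3]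
  note bu = B[OF assms(1)] and bv = B[OF assms(2)] and bw = B[OF w(1)]
  \<comment> \<open>All three values lie in the same interval of length 1, which confines the
    integer correction to -1, 0, 1.\<close>
  have *: "real_of_int d < golden_conj + 2" "golden_conj - 1 < real_of_int d"
    using eq conjunct1[OF bu] conjunct1[OF bv] conjunct1[OF bw]
      conjunct1[OF conjunct2[OF bu]] conjunct1[OF conjunct2[OF bv]]
      conjunct1[OF conjunct2[OF bw]]
    by linarith+
  have "real_of_int d < of_int 2" "of_int (-2) < real_of_int d"
    by (rule order.strict_trans[OF *(1)] order.strict_trans[OF _ *(2)], use b in simp)+
  then have d: "d = -1 \<or> d = 0 \<or> d = 1" by linarith
  have "w \<noteq> [] \<and> hd w = 1 \<longleftrightarrow> shift_window (?s u + ?s v)"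
    unfolding shift_window_def golden_conj_pow2 golden_conj_pow3 power_one_right
    using d eq bu bv bw b by (smt (verit) of_int_0 of_int_1 of_int_minus)
  moreover have "fib_word (lsd_value w) = of_bool (w \<noteq> [] \<and> hd w = 1)"
    using fib_word_lsd_value[OF w(1)] fib_word_binary[of "lsd_value w"] by auto
  ultimately show ?thesis using w(2) by simp
qed


section \<open>Residuals of the shifted Fibonacci word\<close>

text \<open>\<open>e\<close> records that the word read so far ends with the digit \<open>1\<close>.\<close>

definition residual_of :: "bool \<Rightarrow> (real \<Rightarrow> bool) \<Rightarrow> nat list \<Rightarrow> nat option" where
  "residual_of e P = (\<lambda>v. if zeck_valid v \<and> \<not> (e \<and> v \<noteq> [] \<and> hd v = 1)
     then Some (of_bool (P (lsd_eval golden_conj v))) else None)"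

lemma residual_of_cong:
  assumes "\<And>x. \<bar>x\<bar> < 1 \<Longrightarrow> P x \<longleftrightarrow> Q x"
  shows "residual_of e P = residual_of e Q"
  unfolding residual_of_def using assms abs_lsd_eval_golden_conj_less by auto

lemma zeck_residual_shift:
  assumes "zeck_valid w" "zeck_valid u"
  shows "zeck_residual (\<lambda>w. fib_word (lsd_value w + lsd_value u)) w =
    residual_of (w \<noteq> [] \<and> last w = 1) (\<lambda>x. shift_window
      (lsd_eval golden_conj w + lsd_eval golden_conj u + golden_conj ^ length w * x))"
proof
  fix v
  show "zeck_residual (\<lambda>w. fib_word (lsd_value w + lsd_value u)) w v =
    residual_of (w \<noteq> [] \<and> last w = 1) (\<lambda>x. shift_window
      (lsd_eval golden_conj w + lsd_eval golden_conj u + golden_conj ^ length w * x)) v"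
    using fib_word_add[of "w @ v" u] assms
    by (auto simp: zeck_residual_def residual_of_def zeck_valid_append lsd_eval_append
        algebra_simps)
qed

text \<open>The smallest gap between thresholds is \<psi>^2, about 0.38, while \<open>y + d\<close>
  is within 2\<psi>^4, about 0.29, of the given one. The window opens upwards only at
  \<open>j = 3\<close>.\<close>

lemma shift_window_near:
  assumes j: "j \<in> {1, 2, 3}" and "\<bar>y + golden_conj ^ j\<bar> \<le> e" "e \<le> golden_conj ^ 4" "\<bar>d\<bar> < e"
  shows "shift_window (y + d) \<longleftrightarrow>
    (if j = 3 then 0 < y + d + golden_conj ^ j else y + d + golden_conj ^ j < 0)"
proof -
  note b = golden_conj_bounds
  note p = golden_conj_pow2 golden_conj_pow3 power_one_right
  have d: "- e < d" "d < e" and y: "- e \<le> y + golden_conj ^ j" "y + golden_conj ^ j \<le> e"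
    and e: "e \<le> 3 * golden_conj + 2"
    using assms(2-4) unfolding golden_conj_pow4 by linarith+
  have "j = 1 \<or> j = 2 \<or> j = 3" using j by simp
  then show ?thesis
  proof (elim disjE)
    assume j: "j = 1"
    have "\<not> y + d < - (golden_conj + 1)" "- (2 * golden_conj + 1) < y + d"
      using d y e b unfolding j p by linarith+
    then show ?thesis unfolding shift_window_def j p by auto
  next
    assume j: "j = 2"
    have "\<not> - (2 * golden_conj + 1) < y + d"
      using d y e b unfolding j p by linarith+
    then show ?thesis unfolding shift_window_def j p by auto
  next
    assume j: "j = 3"
    have "\<not> y + d < - (golden_conj + 1)" "y + d < - golden_conj"
      using d y e b unfolding j p by linarith+
    then show ?thesis unfolding shift_window_def j p by auto
  qed
qed

lemma shift_window_far:
  assumes "\<And>j. j \<in> {1, 2, 3} \<Longrightarrow> e < \<bar>y + golden_conj ^ j\<bar>" "\<bar>d\<bar> < e"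
  shows "shift_window (y + d) \<longleftrightarrow> shift_window y"
  unfolding shift_window_def using assms(1)[of 1] assms(1)[of 2] assms(1)[of 3] assms(2)
  by (smt (verit) insertI1 insertI2)

text \<open>These belong to the prefixes still undecided at threshold \<open>j\<close>. After
  scaling, a continuation with evaluation \<open>x\<close> is judged by the sign of
  \<open>z + x\<close>.\<close>

definition scaled_offsets :: "nat list \<Rightarrow> nat \<Rightarrow> nat \<Rightarrow> real set" where
  "scaled_offsets u t j =
     {(lsd_eval golden_conj w + lsd_eval golden_conj u + golden_conj ^ j) / golden_conj ^ t | w.
       zeck_valid w \<and> length w = t \<and>
       \<bar>lsd_eval golden_conj w + lsd_eval golden_conj u + golden_conj ^ j\<bar> \<le> \<bar>golden_conj ^ t\<bar>}"

lemma golden_cube_le: "golden ^ 3 \<le> 5"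
proof -
  have "golden ^ 3 = 2 * golden + 1"
    using golden_sq by (simp add: power3_eq_cube algebra_simps)
  then show ?thesis using golden_bounds by simp
qed

lemma abs_scaled_offset_le: "z \<in> scaled_offsets u t j \<Longrightarrow> \<bar>z\<bar> \<le> 1"
  using golden_conj_bounds by (auto simp: scaled_offsets_def divide_le_eq_1)

text \<open>The contributions of \<open>u\<close> and of the threshold cancel, so the conjugate is
  bounded independently of \<open>u\<close> and \<open>t\<close>.\<close>

lemma scaled_offsets_diff:
  assumes "z \<in> scaled_offsets u t j" "z' \<in> scaled_offsets u t j"
  shows "z - z' \<in> golden_box"
proof -
  obtain w w' where w: "zeck_valid w" "length w = t" "zeck_valid w'" "length w' = t"
    and z: "z = (lsd_eval golden_conj w + lsd_eval golden_conj u + golden_conj ^ j) / golden_conj ^ t"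
      "z' = (lsd_eval golden_conj w' + lsd_eval golden_conj u + golden_conj ^ j) / golden_conj ^ t"
    using assms by (auto simp: scaled_offsets_def)
  have "z - z' = (lsd_eval golden_conj w - lsd_eval golden_conj w') / golden_conj ^ t"
    unfolding z by (simp flip: diff_divide_distrib)
  then have "golden_pair (z - z') ((lsd_eval golden w - lsd_eval golden w') / golden ^ t)"
    by (simp add: golden_pair_divide_power golden_pair_diff golden_pair_lsd_eval)
  moreover have "\<bar>z - z'\<bar> \<le> 2"
    using abs_scaled_offset_le[OF assms(1)] abs_scaled_offset_le[OF assms(2)] by linarith
  moreover have "\<bar>(lsd_eval golden w - lsd_eval golden w') / golden ^ t\<bar> \<le> 15"
  proof -
    have pos: "0 < golden ^ t" using golden_bounds by simp
    have "golden ^ 3 * golden ^ t \<le> 15 * golden ^ t"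
      using pos golden_cube_le by (intro mult_right_mono) auto
    then have "\<bar>lsd_eval golden w - lsd_eval golden w'\<bar> \<le> 15 * golden ^ t"
      using lsd_eval_golden_bounds[OF w(1)] lsd_eval_golden_bounds[OF w(3)]
      unfolding w(2,4) by linarith
    then show ?thesis using pos by (simp add: pos_divide_le_eq flip: abs_div_pos)
  qed
  ultimately show ?thesis by (rule golden_boxI)
qed

text \<open>The whole set lies in the translate of \<open>golden_box\<close> by any one of its
  elements.\<close>

lemma finite_card_scaled_offsets:
  "finite (scaled_offsets u t j) \<and> card (scaled_offsets u t j) \<le> card golden_box"
proof (cases "scaled_offsets u t j = {}")
  case False
  then obtain z where "z \<in> scaled_offsets u t j" by blast
  then have "scaled_offsets u t j \<subseteq> (\<lambda>x. x + z) ` golden_box"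
    using scaled_offsets_diff[of _ u t j z] by (force simp: image_iff)
  then show ?thesis
    using finite_golden_box card_image_le[of golden_box "\<lambda>x. x + z"]
    by (meson card_mono finite_imageI finite_subset le_trans)
qed simp

text \<open>Once \<open>t\<close> reaches \<open>length u\<close>, division by
  \<open>golden ^ t\<close> also bounds the conjugate of \<open>u\<close>, so one box serves all
  these \<open>t\<close>.\<close>

lemma scaled_offsets_late:
  assumes "zeck_valid u" "length u \<le> t" "j \<in> {1, 2, 3}"
  shows "scaled_offsets u t j \<subseteq> golden_box"
proof
  fix z assume z: "z \<in> scaled_offsets u t j"
  then obtain w where w: "zeck_valid w" "length w = t"
    and zw: "z = (lsd_eval golden_conj w + lsd_eval golden_conj u + golden_conj ^ j) / golden_conj ^ t"
    by (auto simp: scaled_offsets_def)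
  let ?y = "lsd_eval golden w + lsd_eval golden u + golden ^ j"
  have "golden_pair z (?y / golden ^ t)"
    unfolding zw by (intro golden_pair_divide_power golden_pair_add golden_pair_lsd_eval
        golden_pair_power golden_pair_conj)
  moreover have "\<bar>?y / golden ^ t\<bar> \<le> 15"
  proof -
    have g: "1 \<le> golden" using golden_bounds by simp
    have "golden ^ 3 * golden ^ length u \<le> golden ^ 3 * golden ^ t"
      using g assms(2) by (intro mult_left_mono power_increasing) auto
    moreover have "golden ^ j \<le> golden ^ 3"
      using g assms(3) by (intro power_increasing) auto
    moreover have "golden ^ 3 * 1 \<le> golden ^ 3 * golden ^ t"
      using g by (intro mult_left_mono) auto
    moreover have "golden ^ 3 * golden ^ t \<le> 5 * golden ^ t"
      using g golden_cube_le by (intro mult_right_mono) auto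
    moreover have "0 \<le> golden ^ j" using g by simp
    ultimately have "\<bar>?y\<bar> \<le> 15 * golden ^ t"
      using lsd_eval_golden_bounds[OF w(1)] lsd_eval_golden_bounds[OF assms(1)] w(2) by auto
    moreover have "0 < golden ^ t" using g by simp
    ultimately show ?thesis by (simp add: pos_divide_le_eq flip: abs_div_pos)
  qed
  moreover have "\<bar>z\<bar> \<le> 2" using abs_scaled_offset_le[OF z] by linarith
  ultimately show "z \<in> golden_box" by (intro golden_boxI)
qed

text \<open>Constant tests are for decided prefixes, the two sign tests for undecided ones. Only
  \<open>t < length u\<close> needs separate sets, which makes the count linear in
  \<open>length u\<close>.\<close>

definition residual_tests :: "nat list \<Rightarrow> (real \<Rightarrow> bool) set" where
  "residual_tests u =
     (let Z = golden_box \<union> (\<Union>(t, j)\<in>{..<length u} \<times> {1, 2, 3}. scaled_offsets u t j)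
      in (\<lambda>b x. b) ` UNIV \<union> (\<lambda>z x. z + x < 0) ` Z \<union> (\<lambda>z x. 0 < z + x) ` Z)"

lemma finite_card_residual_tests:
  "finite (residual_tests u) \<and>
    card (residual_tests u) \<le> 2 + 2 * (card golden_box + 3 * length u * card golden_box)"
proof -
  define O' where "O' = (\<Union>(t, j)\<in>{..<length u} \<times> {1, 2, 3}. scaled_offsets u t j)"
  let ?Z = "golden_box \<union> O'"
  have fin: "finite ?Z"
    using finite_golden_box finite_card_scaled_offsets by (auto simp: O'_def)
  have "card O' \<le> (\<Sum>(t, j)\<in>{..<length u} \<times> {1, 2, 3}. card (scaled_offsets u t j))"
    unfolding O'_def using card_UN_le[of "{..<length u} \<times> {1, 2, 3}" "\<lambda>(t, j). scaled_offsets u t j"]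
    by (simp add: case_prod_beta)
  also have "\<dots> \<le> (\<Sum>(t, j)\<in>{..<length u} \<times> {1, 2, 3::nat}. card golden_box)"
    using finite_card_scaled_offsets by (intro sum_mono) auto
  also have "\<dots> = 3 * length u * card golden_box" by (simp add: case_prod_beta)
  finally have Z: "card ?Z \<le> card golden_box + 3 * length u * card golden_box"
    using card_Un_le[of golden_box O'] by linarith
  have T: "residual_tests u =
      (\<lambda>b x. b) ` UNIV \<union> (\<lambda>z x. z + x < 0) ` ?Z \<union> (\<lambda>z x. 0 < z + x) ` ?Z"
    by (simp add: residual_tests_def O'_def Let_def)
  have "card (residual_tests u) \<le> card ((\<lambda>(b::bool) (x::real). b) ` UNIV)
      + card ((\<lambda>(z::real) x. z + x < 0) ` ?Z) + card ((\<lambda>(z::real) x. 0 < z + x) ` ?Z)"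
    unfolding T by (meson add_le_mono card_Un_le le_refl le_trans)
  moreover have "card ((\<lambda>(b::bool) (x::real). b) ` UNIV) \<le> 2"
    using card_image_le[of "UNIV :: bool set" "\<lambda>(b::bool) (x::real). b"] by simp
  ultimately show ?thesis
    using Z fin card_image_le[OF fin, of "\<lambda>(z::real) x. z + x < 0"]
      card_image_le[OF fin, of "\<lambda>(z::real) x. 0 < z + x"]
    by (auto simp: T)
qed

text \<open>A prefix of length at least \<open>4\<close> determines the value up to less than the gap between
  two thresholds, so that at most one of them remains undecided.\<close>

lemma zeck_residual_shift_cases:
  assumes w: "zeck_valid w" "4 \<le> length w" and u: "zeck_valid u"
  shows "zeck_residual (\<lambda>w. fib_word (lsd_value w + lsd_value u)) w \<in>
    (\<lambda>(e, P). residual_of e P) ` (UNIV \<times> residual_tests u)"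
proof -
  define t where "t = length w"
  define y where "y = lsd_eval golden_conj w + lsd_eval golden_conj u"
  let ?r = golden_conj
  have e: "\<bar>?r ^ t\<bar> \<le> ?r ^ 4" "0 < \<bar>?r ^ t\<bar>"
    using power_decreasing[of 4 t "\<bar>?r\<bar>"] w(2) golden_conj_bounds
    by (auto simp: t_def power_abs)
  have d: "\<bar>?r ^ t * x\<bar> < \<bar>?r ^ t\<bar>" if "\<bar>x\<bar> < 1" for x
    using that e(2) by (simp add: abs_mult)
  have res: "zeck_residual (\<lambda>w. fib_word (lsd_value w + lsd_value u)) w =
      residual_of (w \<noteq> [] \<and> last w = 1) (\<lambda>x. shift_window (y + ?r ^ t * x))"
    unfolding y_def t_def by (rule zeck_residual_shift[OF w(1) u])
  have "\<exists>P\<in>residual_tests u. \<forall>x. \<bar>x\<bar> < 1 \<longrightarrow> (shift_window (y + ?r ^ t * x) \<longleftrightarrow> P x)"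
  proof (cases "\<exists>j\<in>{1, 2, 3}. \<bar>y + ?r ^ j\<bar> \<le> \<bar>?r ^ t\<bar>")
    case True
    then obtain j where j: "j \<in> {1, 2, 3}" "\<bar>y + ?r ^ j\<bar> \<le> \<bar>?r ^ t\<bar>" by blast
    define z where "z = (y + ?r ^ j) / ?r ^ t"
    have "z \<in> scaled_offsets u t j"
      using w j(2) unfolding scaled_offsets_def z_def y_def t_def by blast
    then have "z \<in> golden_box \<or> t < length u \<and> z \<in> scaled_offsets u t j"
      using scaled_offsets_late[OF u _ j(1)] by (meson not_le subsetD)
    then have "z \<in> golden_box \<union> (\<Union>(t, j)\<in>{..<length u} \<times> {1, 2, 3}. scaled_offsets u t j)"
      using j(1) by blast
    then have P: "(\<lambda>x. z + x < 0) \<in> residual_tests u" "(\<lambda>x. 0 < z + x) \<in> residual_tests u"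
      unfolding residual_tests_def Let_def
      by - (rule UnI1, rule UnI2, erule imageI, rule UnI2, erule imageI)
    have mult: "y + ?r ^ t * x + ?r ^ j = ?r ^ t * (z + x)" for x
      using e by (simp add: z_def field_simps)
    have H: "shift_window (y + ?r ^ t * x) \<longleftrightarrow>
        (if j = 3 then 0 < ?r ^ t * (z + x) else ?r ^ t * (z + x) < 0)" if "\<bar>x\<bar> < 1" for x
      using shift_window_near[OF j(1,2) e(1) d[OF that]] unfolding mult .
    have sgn: "if even t then 0 < ?r ^ t else ?r ^ t < 0"
      using golden_conj_bounds by (simp add: zero_less_power_eq power_less_zero_eq)
    \<comment> \<open>Dividing by \<open>golden_conj ^ t\<close> reverses the inequality exactly for
      odd \<open>t\<close>.\<close>
    have H': "shift_window (y + ?r ^ t * x) \<longleftrightarrow>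
        (if (j = 3) = even t then 0 < z + x else z + x < 0)" if "\<bar>x\<bar> < 1" for x
      using H[OF that] sgn
      by (cases "even t"; cases "j = 3")
        (simp_all only: if_True if_False simp_thms zero_less_mult_iff mult_less_0_iff, linarith+)
    show ?thesis
    proof (cases "(j = 3) = even t")
      case True
      then show ?thesis using H' by (intro bexI[OF _ P(2)]) simp
    next
      case False
      then show ?thesis using H' by (intro bexI[OF _ P(1)]) simp
    qed
  next
    case False
    then have "shift_window (y + ?r ^ t * x) \<longleftrightarrow> shift_window y" if "\<bar>x\<bar> < 1" for x
      by (intro shift_window_far[OF _ d[OF that]]) (meson not_le)
    moreover have "(\<lambda>x. shift_window y) \<in> residual_tests u"
      unfolding residual_tests_def Let_def by blast
    ultimately show ?thesis by (intro bexI[of _ "\<lambda>x. shift_window y"]) auto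
  qed
  then obtain P where P: "P \<in> residual_tests u"
    "\<And>x. \<bar>x\<bar> < 1 \<Longrightarrow> shift_window (y + ?r ^ t * x) \<longleftrightarrow> P x" by blast
  have "zeck_residual (\<lambda>w. fib_word (lsd_value w + lsd_value u)) w =
      residual_of (w \<noteq> [] \<and> last w = 1) P"
    unfolding res by (rule residual_of_cong) (rule P(2))
  then show ?thesis
    using P(1) by (intro image_eqI[of _ _ "(w \<noteq> [] \<and> last w = 1, P)"]) simp_all
qed

text \<open>Contains the prefixes too short for the threshold analysis; they add only a constant
  number of residuals.\<close>

definition short_words :: "nat list set" where
  "short_words = {w. set w \<subseteq> {0, 1} \<and> length w \<le> 4}"

lemma finite_short_words: "finite short_words"
  unfolding short_words_def by (rule finite_lists_length_le) simp

lemma finite_card_zeck_residual_shift: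
  fixes u :: "nat list"
  assumes u: "zeck_valid u"
  defines "R \<equiv> zeck_residual (\<lambda>w. fib_word (lsd_value w + lsd_value u)) ` {w. zeck_valid w}"
  shows "finite R \<and> card R \<le>
    card short_words + 4 + 4 * (card golden_box + 3 * length u * card golden_box)"
proof -
  define g where "g = (\<lambda>w. fib_word (lsd_value w + lsd_value u))"
  define T where "T = (UNIV :: bool set) \<times> residual_tests u"
  \<comment> \<open>The factor 2 comes from the flag for a final digit 1.\<close>
  have T: "finite T" "card T \<le> 2 * (2 + 2 * (card golden_box + 3 * length u * card golden_box))"
    using finite_card_residual_tests[of u] by (auto simp: T_def)
  have sub: "R \<subseteq> zeck_residual g ` short_words \<union> (\<lambda>(e, P). residual_of e P) ` T"
  proof
    fix \<rho> assume "\<rho> \<in> R"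
    then obtain w where w: "zeck_valid w" "\<rho> = zeck_residual g w"
      by (auto simp: R_def g_def)
    show "\<rho> \<in> zeck_residual g ` short_words \<union> (\<lambda>(e, P). residual_of e P) ` T"
    proof (cases "4 \<le> length w")
      case True
      then show ?thesis
        using zeck_residual_shift_cases[OF w(1) _ u] w(2) by (auto simp: g_def T_def)
    next
      case False
      then have "w \<in> short_words" using w(1) by (simp add: short_words_def zeck_valid_def)
      then show ?thesis using w(2) by blast
    qed
  qed
  have fin: "finite (zeck_residual g ` short_words \<union> (\<lambda>(e, P). residual_of e P) ` T)"
    using finite_short_words T by simp
  have "card R \<le> card (zeck_residual g ` short_words) + card ((\<lambda>(e, P). residual_of e P) ` T)"
    using card_mono[OF fin sub] card_Un_le le_trans by blast
  also have "\<dots> \<le> card short_words + card T"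
    using finite_short_words T by (intro add_mono card_image_le) auto
  finally show ?thesis using T finite_subset[OF sub fin] by simp
qed

section \<open>The length of a representation\<close>

text \<open>Advancing the index by two at least doubles a positive-index Fibonacci number.\<close>

lemma two_power_le_fib: "2 ^ (n div 2) \<le> fib (n + 1)"
proof (induction n rule: nat_less_induct)
  case (1 n)
  show ?case
  proof (cases "n < 2")
    case True
    then have "n = 0 \<or> n = 1" by auto
    then show ?thesis by auto
  next
    case False
    then obtain k where k: "n = Suc (Suc k)" by (metis add_2_eq_Suc le_Suc_ex not_less)
    have "fib (Suc k) \<le> fib (Suc (Suc k))" by (rule fib_mono) simp
    then show ?thesis using 1[rule_format, of k] k by simp
  qed
qed

lemma length_zeckendorf_lsd:
  assumes "c \<ge> 2"
  shows "real (length (zeckendorf_lsd c)) \<le> 3 * ln c / ln 2"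
proof -
  let ?u = "zeckendorf_lsd c" and ?h = "length (zeckendorf_lsd c) div 2"
  have c: "lsd_value ?u = c" "?u = [] \<or> last ?u = 1"
    using is_zeckendorf_zeckendorf_lsd[of c] by (auto simp: is_zeckendorf_lsd_def)
  \<comment> \<open>The top digit is 1 and sits at position \<open>length ?u - 1\<close>.\<close>
  have "fib (length ?u + 1) \<le> c"
  proof (cases ?u rule: rev_cases)
    case (snoc v a)
    then show ?thesis using c lsd_value_snoc[of v a] by simp
  qed (use assms in simp)
  then have "2 ^ ?h \<le> c" using two_power_le_fib[of "length ?u"] by linarith
  then have "(2::real) ^ ?h \<le> real c" by (metis of_nat_le_iff of_nat_numeral of_nat_power)
  then have "ln ((2::real) ^ ?h) \<le> ln (real c)" using assms by (subst ln_le_cancel_iff) auto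
  then have "?h * ln 2 \<le> ln (real c)" by (simp add: ln_realpow)
  moreover have "ln 2 \<le> ln (real c)" using assms by simp
  \<comment> \<open>The rounding loss 1 is absorbed by \<open>ln 2 \<le> ln (real c)\<close>,
    turning the factor 2 into 3.\<close>
  moreover have "real (length ?u) \<le> 2 * ?h + 1" by linarith
  then have "real (length ?u) * ln 2 \<le> (2 * ?h + 1) * ln 2" by (rule mult_right_mono) simp
  ultimately have "real (length ?u) * ln 2 \<le> 3 * ln c" by (simp add: algebra_simps)
  then show ?thesis by (simp add: pos_le_divide_eq)
qed

theorem theorem1:
  shows "\<exists>K::real. \<forall>c::nat. \<exists>M::(nat, nat, nat) dfao.
    fibonacci_dfao M \<and> lsd_generates M (\<lambda>i. fib_word (i + c)) \<and>
    (c \<ge> 2 \<longrightarrow> real (card (states M)) \<le> K * ln (real c))"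
proof -
  define A where "A = card short_words + 4 + 4 * card golden_box"
  define B where "B = 12 * card golden_box"
  show ?thesis
  \<comment> \<open>\<open>A\<close> is absorbed through \<open>1 \<le> ln (real c) / ln 2\<close>;
    \<open>3 * B\<close> comes from the bound on \<open>length u\<close>.\<close>
  proof (intro exI[of _ "(real A + 3 * real B) / ln 2"] allI)
    fix c :: nat
    define u where "u = zeckendorf_lsd c"
    have u: "zeck_valid u" "lsd_value u = c"
      using is_zeckendorf_zeckendorf_lsd[of c] by (auto simp: is_zeckendorf_lsd_def u_def)
    let ?g = "\<lambda>w. fib_word (lsd_value w + c)"
    let ?R = "zeck_residual ?g ` {w. zeck_valid w}"
    have R: "finite ?R" "card ?R \<le> A + B * length u"
      using finite_card_zeck_residual_shift[OF u(1)] u(2)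
      by (auto simp: A_def B_def algebra_simps)
    obtain M :: "(nat, nat, nat) dfao" where M: "fibonacci_dfao M" "card (states M) = card ?R"
      "\<And>w. zeck_valid w \<Longrightarrow> \<exists>q. run M (initial M) w = Some q \<and> out M q = ?g w"
      using dfao_of_zeck_residuals[OF R(1)] fib_word_binary by blast
    have "lsd_generates M (\<lambda>i. fib_word (i + c))"
      unfolding lsd_generates_def
    proof (intro allI)
      fix i k
      have i: "zeck_valid (zeckendorf_lsd i)" "lsd_value (zeckendorf_lsd i) = i"
        using is_zeckendorf_zeckendorf_lsd[of i] by (auto simp: is_zeckendorf_lsd_def)
      have "zeck_valid (zeckendorf_lsd i @ replicate k 0)"
        using i zeck_valid_replicate_0[of k] by (cases k) (simp_all add: zeck_valid_append)
      from M(3)[OF this]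
      show "\<exists>q. run M (initial M) (zeckendorf_lsd i @ replicate k 0) = Some q \<and>
          out M q = fib_word (i + c)"
        by (simp add: lsd_value_append_zeros i)
    qed
    moreover have "real (card (states M)) \<le> (real A + 3 * real B) / ln 2 * ln (real c)"
      if c: "c \<ge> 2"
    proof -
      have "real (card (states M)) \<le> real A + real B * real (length u)"
        using R(2) M(2) by (metis of_nat_add of_nat_le_iff of_nat_mult)
      also have "\<dots> \<le> real A * (ln c / ln 2) + real B * (3 * ln c / ln 2)"
      proof (intro add_mono)
        have "1 \<le> ln (real c) / ln 2" using c by simp
        then show "real A \<le> real A * (ln c / ln 2)" 
          using mult_left_mono[of 1 _ "real A"] by fastforce
        show "real B * real (length u) \<le> real B * (3 * ln c / ln 2)"
          unfolding u_def by (rule mult_left_mono[OF length_zeckendorf_lsd[OF c]]) simp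
      qed
      finally show ?thesis by (simp add: field_simps)
    qed
    ultimately show "\<exists>M::(nat, nat, nat) dfao.
        fibonacci_dfao M \<and> lsd_generates M (\<lambda>i. fib_word (i + c)) \<and>
        (c \<ge> 2 \<longrightarrow> real (card (states M)) \<le> (real A + 3 * real B) / ln 2 * ln (real c))"
      using M(1) by blast
  qed
qed

end
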